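(* Let $p\geq 2$ and $k\geq 1$ be integers ($k$ a constant). Consider the algorithm which, given a $p$-claw free graph $G$, for $i=1,\dots,k$ constructs a maximal independent set $I_i$ of the graph $G-(I_1\cup\dots\cup I_{i-1})$, and outputs $D=I_1\cup\dots\cup I_k$. This algorithm runs in polynomial time, and its output $D$ is a $k$-dominating set of $G$ with $|D|\leq \max\{p-1,k\}\cdot\gamma_k(G)$.
   Context: All graphs are finite, simple, undirected and have no isolated vertices. A graph is $p$-claw free if it has no induced subgraph isomorphic to $K_{1,p}$. A set $D\subseteq V(G)$ is a $k$-dominating set if every vertex $v\notin D$ has at least $k$ neighbors in $D$; $\gamma_k(G)$ is the minimum cardinality of a $k$-dominating set of $G$. *)

theory Defs
  imports
    "Graph_Theory.Graph_Theory"
    "HOL-Computational_Algebra.Polynomial"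
begin

section \<open>Domination and claws\<close>

text \<open>
  The locale predicate \<open>graph\<close> of the imported library describes finite symmetric digraphs without
  loops and parallel arcs, that is, finite simple undirected graphs; \<open>u \<rightarrow>\<^bsub>G\<^esub> v\<close> is adjacency.
\<close>

definition no_isolated_vertices :: "('a,'b) pre_digraph \<Rightarrow> bool" where
  "no_isolated_vertices G \<longleftrightarrow> (\<forall>v\<in>verts G. \<exists>u\<in>verts G. v \<rightarrow>\<^bsub>G\<^esub> u)"

text \<open>The predicate \<open>K\<^bsub>1,p\<^esub>\<close> holds for every graph isomorphic to the star with \<open>p\<close> leaves.\<close>

definition claw_free :: "nat \<Rightarrow> ('a,'b) pre_digraph \<Rightarrow> bool" where
  "claw_free p G \<longleftrightarrow> \<not> (\<exists>H. induced_subgraph H G \<and> K\<^bsub>1,p\<^esub> H)"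

definition k_dominating_set :: "nat \<Rightarrow> ('a,'b) pre_digraph \<Rightarrow> 'a set \<Rightarrow> bool" where
  "k_dominating_set k G D \<longleftrightarrow>
     D \<subseteq> verts G \<and> (\<forall>v\<in>verts G - D. card {u\<in>D. v \<rightarrow>\<^bsub>G\<^esub> u} \<ge> k)"

definition k_domination_number :: "nat \<Rightarrow> ('a,'b) pre_digraph \<Rightarrow> nat" where
  "k_domination_number k G = (LEAST m. \<exists>D. k_dominating_set k G D \<and> card D = m)"

definition independent_set :: "('a,'b) pre_digraph \<Rightarrow> 'a set \<Rightarrow> bool" where
  "independent_set G I \<longleftrightarrow> I \<subseteq> verts G \<and> (\<forall>u\<in>I. \<forall>v\<in>I. \<not> u \<rightarrow>\<^bsub>G\<^esub> v)"

definition maximal_independent_set :: "('a,'b) pre_digraph \<Rightarrow> 'a set \<Rightarrow> bool" where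
  "maximal_independent_set G I \<longleftrightarrow>
     independent_set G I \<and> (\<forall>J. independent_set G J \<and> I \<subseteq> J \<longrightarrow> J = I)"

definition remove_vertices :: "('a,'b) pre_digraph \<Rightarrow> 'a set \<Rightarrow> ('a,'b) pre_digraph" where
  "remove_vertices G X = G \<restriction> (verts G - X)"

text \<open>
  The algorithm leaves the choice of each maximal independent set open. A run is one admissible
  sequence of choices \<open>I 1, \<dots>, I k\<close>.
\<close>

definition algorithm_run :: "nat \<Rightarrow> ('a,'b) pre_digraph \<Rightarrow> (nat \<Rightarrow> 'a set) \<Rightarrow> bool" where
  "algorithm_run k G I \<longleftrightarrow>
     (\<forall>i\<in>{1..k}. maximal_independent_set (remove_vertices G (\<Union>j\<in>{1..<i}. I j)) (I i))"

definition run_output :: "nat \<Rightarrow> (nat \<Rightarrow> 'a set) \<Rightarrow> 'a set" where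
  "run_output k I = (\<Union>i\<in>{1..k}. I i)"


section \<open>Machine model\<close>

text \<open>
  Running time is measured on a unit-cost random access machine with addition and truncated
  subtraction but no multiplication, presented as a structured language whose memory consists of
  named arrays of natural numbers. A program uses only finitely many arrays. In \<open>t\<close> steps the
  bit length of numbers grows by only \<open>O(t)\<close>, so polynomial time on this machine coincides with
  polynomial time on Turing machines.
\<close>

type_synonym vname = string
type_synonym state = "vname \<Rightarrow> nat \<Rightarrow> nat"

datatype aexp = N nat | Arr vname aexp | Plus aexp aexp | Minus aexp aexp

primrec aval :: "aexp \<Rightarrow> state \<Rightarrow> nat" where
  "aval (N n) s = n"
| "aval (Arr x a) s = s x (aval a s)"
| "aval (Plus a b) s = aval a s + aval b s"
| "aval (Minus a b) s = aval a s - aval b s"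

text \<open>
  \<open>Assign x a e\<close> performs \<open>x[a] := e\<close>. Conditions of \<open>If\<close> and \<open>While\<close> are true when nonzero.
\<close>

datatype com =
    Skip
  | Assign vname aexp aexp
  | Seq com com  (infixr \<open>;;\<close> 60)
  | If aexp com com
  | While aexp com

text \<open>\<open>exec c s t s'\<close>: started in \<open>s\<close>, program \<open>c\<close> halts in state \<open>s'\<close> after \<open>t\<close> steps.\<close>

inductive exec :: "com \<Rightarrow> state \<Rightarrow> nat \<Rightarrow> state \<Rightarrow> bool" where
  Skip: "exec Skip s 1 s"
| Assign: "exec (Assign x a e) s 1 (s(x := (s x)(aval a s := aval e s)))"
| Seq: "exec c s t s' \<Longrightarrow> exec d s' t' s'' \<Longrightarrow> exec (c ;; d) s (t + t') s''"
| IfTrue: "aval b s \<noteq> 0 \<Longrightarrow> exec c s t s' \<Longrightarrow> exec (If b c d) s (t + 1) s'"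
| IfFalse: "aval b s = 0 \<Longrightarrow> exec d s t s' \<Longrightarrow> exec (If b c d) s (t + 1) s'"
| WhileFalse: "aval b s = 0 \<Longrightarrow> exec (While b c) s 1 s"
| WhileTrue: "aval b s \<noteq> 0 \<Longrightarrow> exec c s t s' \<Longrightarrow> exec (While b c) s' t' s'' \<Longrightarrow>
    exec (While b c) s (t + t' + 1) s''"

inductive_cases SkipE: "exec Skip s t s'"
inductive_cases AssignE: "exec (Assign x a e) s t s'"
inductive_cases SeqE: "exec (c ;; d) s t s'"
inductive_cases IfE: "exec (If b c d) s t s'"
inductive_cases WhileE: "exec (While b c) s t s'"

lemma exec_deterministic:
  "exec c s t s' \<Longrightarrow> exec c s u s'' \<Longrightarrow> u = t \<and> s'' = s'"
proof (induction arbitrary: u s'' rule: exec.induct)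
  case (Skip s)
  from Skip.prems show ?case by (rule SkipE) simp
next
  case (Assign x a e s)
  from Assign.prems show ?case by (rule AssignE) simp
next
  case (Seq c s t s' d t' s1)
  from Seq.prems show ?case by (rule SeqE) (auto dest!: Seq.IH)
next
  case (IfTrue b s c t s' d)
  from IfTrue.prems show ?case by (rule IfE) (use IfTrue.hyps in \<open>auto dest!: IfTrue.IH\<close>)
next
  case (IfFalse b s d t s' c)
  from IfFalse.prems show ?case by (rule IfE) (use IfFalse.hyps in \<open>auto dest!: IfFalse.IH\<close>)
next
  case (WhileFalse b s c)
  from WhileFalse.prems show ?case by (rule WhileE) (use WhileFalse.hyps in auto)
next
  case (WhileTrue b s c t s' t' s1)
  from WhileTrue.prems show ?case by (rule WhileE) (use WhileTrue.hyps in \<open>auto dest!: WhileTrue.IH\<close>)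
qed

abbreviation Var :: "vname \<Rightarrow> aexp" where
  "Var x \<equiv> Arr x (N 0)"

text \<open>\<open>For x e c\<close> runs \<open>c\<close> for \<open>x = 0, 1, \<dots>\<close> as long as \<open>x < e\<close>.\<close>

definition For :: "vname \<Rightarrow> aexp \<Rightarrow> com \<Rightarrow> com" where
  "For x e c =
     Assign x (N 0) (N 0) ;;
     While (Minus e (Var x)) (c ;; Assign x (N 0) (Plus (Var x) (N 1)))"


section \<open>The algorithm as a program\<close>

text \<open>
  A graph on the vertices \<open>0, \<dots>, n - 1\<close> is given by \<open>n\<close> and its adjacency matrix stored row by
  row, so that the input size is polynomially related to \<open>n\<close>.
\<close>

definition encodes_graph :: "state \<Rightarrow> (nat, nat \<times> nat) pre_digraph \<Rightarrow> bool" where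
  "encodes_graph s G \<longleftrightarrow>
     (let n = s ''n'' 0 in
        verts G = {..<n} \<and>
        (\<forall>u<n. \<forall>v<n. s ''adj'' (u * n + v) = (if u \<rightarrow>\<^bsub>G\<^esub> v then 1 else 0)))"

definition encodes_vertex_set ::
  "state \<Rightarrow> vname \<Rightarrow> (nat, nat \<times> nat) pre_digraph \<Rightarrow> nat set \<Rightarrow> bool" where
  "encodes_vertex_set s x G X \<longleftrightarrow>
     X \<subseteq> verts G \<and> (\<forall>v\<in>verts G. s x v = (if v \<in> X then 1 else 0))"

text \<open>
  A subroutine that, in polynomial time, constructs a maximal independent set of \<open>G - X\<close>, where
  \<open>X\<close> is given in the array \<open>D\<close>, and returns it in the array \<open>I\<close>. It must work for arbitrary initial
  contents of its working memory and must not change the arrays in use by the caller.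
\<close>

definition poly_time_mis_procedure :: "com \<Rightarrow> bool" where
  "poly_time_mis_procedure M \<longleftrightarrow>
     (\<exists>q :: nat poly. \<forall>G X s.
        graph G \<and> encodes_graph s G \<and> encodes_vertex_set s ''D'' G X \<longrightarrow>
        (\<exists>t s' I.
           exec M s t s' \<and> t \<le> poly q (card (verts G)) \<and>
           maximal_independent_set (remove_vertices G X) I \<and>
           encodes_vertex_set s' ''I'' G I \<and>
           (\<forall>x\<in>{''n'', ''adj'', ''D'', ''i''}. s' x = s x)))"

definition algorithm_program :: "nat \<Rightarrow> com \<Rightarrow> com" where
  "algorithm_program k M =
     For ''v'' (Var ''n'') (Assign ''D'' (Var ''v'') (N 0)) ;;
     For ''i'' (N k)
       (M ;;
        For ''v'' (Var ''n'')
          (If (Arr ''I'' (Var ''v'')) (Assign ''D'' (Var ''v'') (N 1)) Skip))"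

end

theory Submission
  imports Defs
begin

text \<open>
  Let \<open>D\<close> be the output and \<open>S\<close> a minimum \<open>k\<close>-dominating set. In a \<open>p\<close>-claw free graph every vertex
  has at most \<open>p - 1\<close> neighbours in each of the independent sets forming \<open>D\<close>, and none in the one
  that contains it. Since a vertex of \<open>D - S\<close> has at least \<open>k\<close> neighbours in \<open>S\<close>, counting the edges
  between \<open>D - S\<close> and \<open>S\<close> gives
  \<open>k * \<bar>D - S\<bar> \<le> k * (p - 1) * \<bar>S - D\<bar> + (k - 1) * (p - 1) * \<bar>S \<inter> D\<bar>\<close>. Adding
  \<open>k * \<bar>S \<inter> D\<bar>\<close>, the bound follows from
  \<open>(k - 1) * (p - 1) + k \<le> k * max (p - 1) k\<close>.
\<close>

section \<open>Domination in claw-free graphs\<close>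

lemma dominates_induce_subgraph_iff:
  "u \<rightarrow>\<^bsub>G \<restriction> S\<^esub> v \<longleftrightarrow> u \<in> S \<and> v \<in> S \<and> u \<rightarrow>\<^bsub>G\<^esub> v"
  by (auto simp: arcs_ends_conv)

context graph
begin

lemma dominates_sym: "u \<rightarrow>\<^bsub>G\<^esub> v \<longleftrightarrow> v \<rightarrow>\<^bsub>G\<^esub> u"
  using sym_arcs arcs_ends_symmetric by metis

text \<open>Maximality need only be tested on one-vertex extensions, as a larger independent set
  yields a vertex without neighbours in \<open>I\<close>. Maximal independent sets thus become
  independent dominating sets of the remaining graph, the form used for runs and for the greedy
  procedure.\<close>

lemma maximal_independent_remove_iff:
  "maximal_independent_set (remove_vertices G X) I \<longleftrightarrow>
     I \<subseteq> verts G - X \<and> (\<forall>u\<in>I. \<forall>v\<in>I. \<not> u \<rightarrow>\<^bsub>G\<^esub> v) \<and>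
     (\<forall>v\<in>verts G - X - I. \<exists>u\<in>I. v \<rightarrow>\<^bsub>G\<^esub> u)"
  (is "?L \<longleftrightarrow> ?R")
proof -
  have ind: "independent_set (remove_vertices G X) J \<longleftrightarrow>
      J \<subseteq> verts G - X \<and> (\<forall>u\<in>J. \<forall>v\<in>J. \<not> u \<rightarrow>\<^bsub>G\<^esub> v)" for J
    by (auto simp: independent_set_def remove_vertices_def dominates_induce_subgraph_iff)
  show ?thesis
  proof
    assume L: ?L
    then have I: "I \<subseteq> verts G - X" "\<forall>u\<in>I. \<forall>v\<in>I. \<not> u \<rightarrow>\<^bsub>G\<^esub> v"
      and max: "\<And>J. independent_set (remove_vertices G X) J \<Longrightarrow> I \<subseteq> J \<Longrightarrow> J = I"
      unfolding maximal_independent_set_def ind by auto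
    have "\<exists>u\<in>I. v \<rightarrow>\<^bsub>G\<^esub> u" if v: "v \<in> verts G - X - I" for v
    proof (rule ccontr)
      assume "\<not> (\<exists>u\<in>I. v \<rightarrow>\<^bsub>G\<^esub> u)"
      then have "independent_set (remove_vertices G X) (insert v I)"
        using I v adj_not_same dominates_sym unfolding ind by blast
      from max[OF this] v show False by blast
    qed
    with I show ?R by blast
  next
    assume R: ?R
    have "J = I" if "independent_set (remove_vertices G X) J" "I \<subseteq> J" for J
      using that R unfolding ind by blast
    with R show ?L unfolding maximal_independent_set_def ind by blast
  qed
qed

text \<open>Any \<open>p\<close> elements of \<open>A\<close> would form with \<open>u\<close> an
  induced star centred at \<open>u\<close>.\<close>

lemma claw_free_independent_neighbours:
  assumes "claw_free p G" and "u \<in> verts G"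
    and A: "A \<subseteq> verts G" "\<And>v. v \<in> A \<Longrightarrow> u \<rightarrow>\<^bsub>G\<^esub> v" "\<And>v w. v \<in> A \<Longrightarrow> w \<in> A \<Longrightarrow> \<not> v \<rightarrow>\<^bsub>G\<^esub> w"
  shows "card A < p"
proof (rule ccontr)
  assume "\<not> card A < p"
  then obtain B where B: "B \<subseteq> A" "card B = p"
    using obtain_subset_with_card_n[of p A] by auto
  define H where "H = G \<restriction> insert u B"
  have sub: "induced_subgraph H G"
    unfolding H_def using A(1) B(1) assms(2) by (intro induced_induce) auto
  interpret H: digraph H using sub by (rule digraphI_induced)
  have "graph H"
    using induced_graph_imp_symmetric[OF sym_arcs sub] by (rule H.graphI)
  have "u \<notin> B" using A(2) B(1) adj_not_same by blast
  have "v \<rightarrow>\<^bsub>H\<^esub> w \<longleftrightarrow> (v, w) \<in> {u} \<times> B \<union> B \<times> {u}" for v w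
  proof -
    have "x \<in> B \<Longrightarrow> u \<rightarrow>\<^bsub>G\<^esub> x \<and> x \<rightarrow>\<^bsub>G\<^esub> u" "x \<in> B \<Longrightarrow> y \<in> B \<Longrightarrow> \<not> x \<rightarrow>\<^bsub>G\<^esub> y" "\<not> u \<rightarrow>\<^bsub>G\<^esub> u" for x y
      using A(2,3) B(1) adj_not_same dominates_sym by blast+
    then show ?thesis by (auto simp: H_def dominates_induce_subgraph_iff)
  qed
  then have "arcs_ends H = {u} \<times> B \<union> B \<times> {u}"
    by (intro equalityI subrelI) simp_all
  with B \<open>u \<notin> B\<close> have "verts H = {u} \<union> B \<and> {u} \<inter> B = {} \<and> card {u} = 1 \<and> card B = p \<and>
      arcs_ends H = {u} \<times> B \<union> B \<times> {u}"
    by (simp add: H_def)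
  with \<open>graph H\<close> have "K\<^bsub>1,p\<^esub> H" unfolding complete_bipartite_digraph_def by blast
  with sub assms(1) show False unfolding claw_free_def by blast
qed

section \<open>Rounds of a run and domination\<close>

lemma algorithm_runD:
  assumes "algorithm_run k G I" and i: "i \<in> {1..k}"
  shows "I i \<subseteq> verts G"
    and "\<And>u v. u \<in> I i \<Longrightarrow> v \<in> I i \<Longrightarrow> \<not> u \<rightarrow>\<^bsub>G\<^esub> v"
    and "\<And>j. j \<in> {1..<i} \<Longrightarrow> I i \<inter> I j = {}"
    and "\<And>v. v \<in> verts G - run_output k I \<Longrightarrow> \<exists>u\<in>I i. v \<rightarrow>\<^bsub>G\<^esub> u"
proof -
  have *: "maximal_independent_set (remove_vertices G (\<Union>j\<in>{1..<i}. I j)) (I i)"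
    using assms unfolding algorithm_run_def by blast
  note * = *[unfolded maximal_independent_remove_iff]
  show "I i \<subseteq> verts G" "\<And>u v. u \<in> I i \<Longrightarrow> v \<in> I i \<Longrightarrow> \<not> u \<rightarrow>\<^bsub>G\<^esub> v"
    using * by blast+
  show "I i \<inter> I j = {}" if "j \<in> {1..<i}" for j
    using * that by blast
  show "\<exists>u\<in>I i. v \<rightarrow>\<^bsub>G\<^esub> u" if v: "v \<in> verts G - run_output k I" for v
  proof -
    \<comment> \<open>A vertex outside the output is never removed, so it is still present in round
      \<open>i\<close> without being chosen; maximality of \<open>I i\<close> then supplies the
      neighbour.\<close>
    have "v \<notin> I i" "v \<notin> (\<Union>j\<in>{1..<i}. I j)"
      using v i unfolding run_output_def by auto
    with * v show ?thesis by blast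
  qed
qed

lemma algorithm_run_disjoint:
  assumes "algorithm_run k G I" "i \<in> {1..k}" "j \<in> {1..k}" "i \<noteq> j"
  shows "I i \<inter> I j = {}"
proof (cases "i < j")
  case True
  then show ?thesis using algorithm_runD(3)[OF assms(1,3), of i] assms(2) by auto
next
  case False
  then show ?thesis using algorithm_runD(3)[OF assms(1,2), of j] assms(3,4) by auto
qed

lemma run_output_subset_verts:
  "algorithm_run k G I \<Longrightarrow> run_output k I \<subseteq> verts G"
  unfolding run_output_def using algorithm_runD(1) by blast

text \<open>Rounds are pairwise disjoint, so a neighbour count splits by rounds. This serves both
  directions: at least one neighbour per round for domination, at most \<open>p - 1\<close> per
  round for the size bound.\<close>

lemma card_run_output_neighbours:
  assumes run: "algorithm_run k G I"
  shows "card {u \<in> run_output k I. v \<rightarrow>\<^bsub>G\<^esub> u} = (\<Sum>i\<in>{1..k}. card {u \<in> I i. v \<rightarrow>\<^bsub>G\<^esub> u})"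
proof -
  have "{u \<in> run_output k I. v \<rightarrow>\<^bsub>G\<^esub> u} = (\<Union>i\<in>{1..k}. {u \<in> I i. v \<rightarrow>\<^bsub>G\<^esub> u})"
    unfolding run_output_def by blast
  moreover have "card (\<Union>i\<in>{1..k}. {u \<in> I i. v \<rightarrow>\<^bsub>G\<^esub> u}) = (\<Sum>i\<in>{1..k}. card {u \<in> I i. v \<rightarrow>\<^bsub>G\<^esub> u})"
  proof (rule card_UN_disjoint)
    show "\<forall>i\<in>{1..k}. finite {u \<in> I i. v \<rightarrow>\<^bsub>G\<^esub> u}"
      using algorithm_runD(1)[OF run] finite_subset[OF _ finite_verts] by fastforce
    show "\<forall>i\<in>{1..k}. \<forall>j\<in>{1..k}. i \<noteq> j \<longrightarrow> {u \<in> I i. v \<rightarrow>\<^bsub>G\<^esub> u} \<inter> {u \<in> I j. v \<rightarrow>\<^bsub>G\<^esub> u} = {}"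
      using algorithm_run_disjoint[OF run] by blast
  qed simp
  ultimately show ?thesis by simp
qed

lemma run_output_dominating:
  assumes run: "algorithm_run k G I"
  shows "k_dominating_set k G (run_output k I)"
  unfolding k_dominating_set_def
proof (intro conjI ballI)
  show "run_output k I \<subseteq> verts G" using run by (rule run_output_subset_verts)
  fix v assume v: "v \<in> verts G - run_output k I"
  have "1 \<le> card {u \<in> I i. v \<rightarrow>\<^bsub>G\<^esub> u}" if i: "i \<in> {1..k}" for i
  proof -
    have "finite {u \<in> I i. v \<rightarrow>\<^bsub>G\<^esub> u}"
      using algorithm_runD(1)[OF run i] finite_subset[OF _ finite_verts] by fastforce
    with algorithm_runD(4)[OF run i v] show ?thesis
      by (metis (mono_tags, lifting) One_nat_def Suc_leI card_gt_0_iff empty_iff mem_Collect_eq)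
  qed
  then have "(\<Sum>i\<in>{1..k}. 1) \<le> (\<Sum>i\<in>{1..k}. card {u \<in> I i. v \<rightarrow>\<^bsub>G\<^esub> u})"
    by (rule sum_mono)
  then show "k \<le> card {u \<in> run_output k I. v \<rightarrow>\<^bsub>G\<^esub> u}"
    by (simp add: card_run_output_neighbours[OF run])
qed

text \<open>Each round is independent and so meets the neighbourhood of \<open>u\<close> in at most
  \<open>p - 1\<close> vertices. If \<open>u\<close> is itself in the output, its own round
  contributes nothing, which lowers the factor to \<open>k - 1\<close>.\<close>

lemma card_run_output_neighbours_le:
  assumes cf: "claw_free p G" and run: "algorithm_run k G I" and u: "u \<in> verts G"
  shows "card {v \<in> run_output k I. u \<rightarrow>\<^bsub>G\<^esub> v} \<le>
    (if u \<in> run_output k I then k - 1 else k) * (p - 1)"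
proof -
  have le: "card {v \<in> I i. u \<rightarrow>\<^bsub>G\<^esub> v} \<le> p - 1" if i: "i \<in> {1..k}" for i
    using claw_free_independent_neighbours[OF cf u, of "{v \<in> I i. u \<rightarrow>\<^bsub>G\<^esub> v}"]
      algorithm_runD(1,2)[OF run i] by fastforce
  show ?thesis
  proof (cases "u \<in> run_output k I")
    case True
    then obtain j where j: "j \<in> {1..k}" "u \<in> I j" unfolding run_output_def by blast
    then have zero: "card {v \<in> I j. u \<rightarrow>\<^bsub>G\<^esub> v} = 0"
      using algorithm_runD(2)[OF run j(1)] by (metis (mono_tags, lifting) card.empty empty_Collect_eq)
    have "(\<Sum>i\<in>{1..k}. card {v \<in> I i. u \<rightarrow>\<^bsub>G\<^esub> v}) = (\<Sum>i\<in>{1..k} - {j}. card {v \<in> I i. u \<rightarrow>\<^bsub>G\<^esub> v})"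
      using j(1) zero by (simp add: sum.remove)
    also have "\<dots> \<le> (\<Sum>i\<in>{1..k} - {j}. p - 1)" using le by (intro sum_mono) auto
    also have "\<dots> = (k - 1) * (p - 1)" using j(1) by simp
    finally show ?thesis using True by (simp add: card_run_output_neighbours[OF run])
  next
    case False
    have "(\<Sum>i\<in>{1..k}. card {v \<in> I i. u \<rightarrow>\<^bsub>G\<^esub> v}) \<le> (\<Sum>i\<in>{1..k}. p - 1)"
      using le by (rule sum_mono)
    then show ?thesis using False by (simp add: card_run_output_neighbours[OF run])
  qed
qed

section \<open>Counting edges between the output and a dominating set\<close>

lemma card_run_output_diff_le:
  assumes cf: "claw_free p G" and run: "algorithm_run k G I" and S: "k_dominating_set k G S"
  defines "D \<equiv> run_output k I"
  shows "k * card (D - S) \<le> k * (p - 1) * card (S - D) + (k - 1) * (p - 1) * card (S \<inter> D)"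
proof -
  have sub: "S \<subseteq> verts G" "D \<subseteq> verts G"
    using S run_output_subset_verts[OF run] unfolding k_dominating_set_def D_def by auto
  then have fin: "finite S" "finite D" using finite_subset[OF _ finite_verts] by auto
  have "k * card (D - S) = (\<Sum>v\<in>D - S. k)" by simp
  also have "\<dots> \<le> (\<Sum>v\<in>D - S. card {u \<in> S. v \<rightarrow>\<^bsub>G\<^esub> u})"
    using S sub unfolding k_dominating_set_def by (intro sum_mono) auto
  \<comment> \<open>The edges between \<open>D - S\<close> and \<open>S\<close> are now counted from
    their ends in \<open>S\<close>.\<close>
  also have "\<dots> = (\<Sum>u\<in>S. card {v \<in> D - S. v \<rightarrow>\<^bsub>G\<^esub> u})"
    using fin by (intro sum_multicount_gen) auto
  \<comment> \<open>Enlarging \<open>D - S\<close> to \<open>D\<close> and reversing adjacency by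
    symmetry makes the degree bound for runs applicable.\<close>
  also have "\<dots> \<le> (\<Sum>u\<in>S. card {v \<in> D. u \<rightarrow>\<^bsub>G\<^esub> v})"
    using fin by (intro sum_mono card_mono) (auto simp: dominates_sym)
  also have "\<dots> \<le> (\<Sum>u\<in>S. (if u \<in> D then k - 1 else k) * (p - 1))"
    using card_run_output_neighbours_le[OF cf run] sub unfolding D_def
    by (intro sum_mono) blast
  also have "\<dots> = (\<Sum>u\<in>S - D. (if u \<in> D then k - 1 else k) * (p - 1)) +
      (\<Sum>u\<in>S \<inter> D. (if u \<in> D then k - 1 else k) * (p - 1))"
    by (subst sum.Int_Diff[OF fin(1), of _ D]) (rule add.commute)
  also have "(\<Sum>u\<in>S - D. (if u \<in> D then k - 1 else k) * (p - 1)) = k * (p - 1) * card (S - D)"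
    by simp
  also have "(\<Sum>u\<in>S \<inter> D. (if u \<in> D then k - 1 else k) * (p - 1)) =
      (k - 1) * (p - 1) * card (S \<inter> D)"
    by simp
  finally show ?thesis .
qed

text \<open>Adding \<open>k * card (S \<inter> D)\<close> to the edge count reconstructs
  \<open>k * card D\<close>; it remains to bound both coefficients by
  \<open>k * max (p - 1) k\<close> and to cancel \<open>k\<close>.\<close>

lemma card_run_output_le:
  assumes k: "k \<ge> 1" and cf: "claw_free p G" and run: "algorithm_run k G I"
    and S: "k_dominating_set k G S"
  shows "card (run_output k I) \<le> max (p - 1) k * card S"
proof -
  define D m c where "D = run_output k I" and "m = p - 1" and "c = max m k"
  have "S \<subseteq> verts G" "D \<subseteq> verts G"
    using S run_output_subset_verts[OF run] unfolding k_dominating_set_def D_def by auto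
  then have fin: "finite S" "finite D" using finite_subset[OF _ finite_verts] by auto
  obtain l where l: "k = Suc l" using k by (cases k) auto
  \<comment> \<open>If \<open>k \<le> m\<close>, then \<open>c = m\<close> and the claim is
    \<open>l * m + k \<le> l * m + m\<close>; otherwise \<open>c = k\<close>, and
    \<open>l * m \<le> l * k\<close> gives it.\<close>
  have coeff: "l * m + k \<le> k * c"
  proof (cases "k \<le> m")
    case True
    then show ?thesis by (simp add: c_def l algebra_simps)
  next
    case False
    then have "l * m \<le> l * k" by simp
    with False show ?thesis by (simp add: c_def l algebra_simps)
  qed
  have "k * card D = k * card (D - S) + k * card (S \<inter> D)"
    using fin card_Int_Diff[of D S] by (simp add: Int_commute algebra_simps)
  also have "\<dots> \<le> k * m * card (S - D) + (l * m + k) * card (S \<inter> D)"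
    using card_run_output_diff_le[OF cf run S] by (simp add: D_def m_def l algebra_simps)
  also have "\<dots> \<le> k * c * card (S - D) + k * c * card (S \<inter> D)"
    using coeff by (intro add_mono mult_right_mono) (auto simp: c_def)
  also have "\<dots> = k * (c * card S)"
    using fin card_Int_Diff[of S D] by (simp add: algebra_simps)
  finally show ?thesis using k by (simp add: D_def c_def m_def)
qed

text \<open>The whole vertex set is vacuously \<open>k\<close>-dominating, so the minimum is taken
  over a nonempty set of sizes.\<close>

lemma k_domination_number_attained:
  obtains S where "k_dominating_set k G S" "card S = k_domination_number k G"
proof -
  have "k_dominating_set k G (verts G)" by (simp add: k_dominating_set_def)
  then have "\<exists>m D. k_dominating_set k G D \<and> card D = m" by blast
  from LeastI_ex[OF this] show ?thesis using that unfolding k_domination_number_def by blast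
qed

end

section \<open>Running times\<close>

text \<open>A time-bounded total-correctness triple with a fixed start state. A bound instead of the
  exact time lets branches of different cost be joined, and a \<open>runs\<close> statement can
  itself be a postcondition, which is how sequences are composed.\<close>

definition runs :: "com \<Rightarrow> state \<Rightarrow> nat \<Rightarrow> (state \<Rightarrow> bool) \<Rightarrow> bool" where
  "runs c s T Q \<longleftrightarrow> (\<exists>t s'. exec c s t s' \<and> t \<le> T \<and> Q s')"

lemma runs_mono:
  "runs c s T Q \<Longrightarrow> T \<le> T' \<Longrightarrow> (\<And>r. Q r \<Longrightarrow> Q' r) \<Longrightarrow> runs c s T' Q'"
  unfolding runs_def using le_trans by blast

lemma runs_Skip: "Q s \<Longrightarrow> runs Skip s 1 Q"
  unfolding runs_def using exec.Skip by blast

lemma runs_Assign: "Q (s(x := (s x)(aval a s := aval e s))) \<Longrightarrow> runs (Assign x a e) s 1 Q"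
  unfolding runs_def using exec.Assign by blast

lemma runs_Seq: "runs c s T (\<lambda>r. runs d r U Q) \<Longrightarrow> runs (c ;; d) s (T + U) Q"
  unfolding runs_def using exec.Seq add_mono by blast

lemma runs_If:
  assumes "aval b s \<noteq> 0 \<Longrightarrow> runs c s T Q" and "aval b s = 0 \<Longrightarrow> runs d s T Q"
  shows "runs (If b c d) s (Suc T) Q"
proof (cases "aval b s = 0")
  case True
  with assms(2) obtain t r where "exec d s t r" "t \<le> T" "Q r" unfolding runs_def by blast
  with exec.IfFalse[OF True] show ?thesis
    unfolding runs_def by (metis Suc_eq_plus1 Suc_le_mono)
next
  case False
  with assms(1) obtain t r where "exec c s t r" "t \<le> T" "Q r" unfolding runs_def by blast
  with exec.IfTrue[OF False] show ?thesis
    unfolding runs_def by (metis Suc_eq_plus1 Suc_le_mono)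
qed

text \<open>\<open>P j\<close> is the invariant when the counter reads \<open>j\<close>. The limit
  \<open>e\<close> is evaluated anew at each test, so \<open>P\<close> must fix its value, and the
  body must end with the counter unchanged. A pass costs the body plus increment and test; the last
  2 pays for initialisation and the failing test.\<close>

lemma runs_For:
  assumes init: "P 0 (s(x := (s x)(0 := 0)))"
    and bound: "\<And>j r. P j r \<Longrightarrow> aval e r = n"
    and step: "\<And>j r. j < n \<Longrightarrow> r x 0 = j \<Longrightarrow> P j r \<Longrightarrow>
      runs c r T (\<lambda>r'. r' x 0 = j \<and> P (Suc j) (r'(x := (r' x)(0 := Suc j))))"
  shows "runs (For x e c) s (n * (T + 2) + 2) (P n)"
proof -
  let ?W = "While (Minus e (Var x)) (c ;; Assign x (N 0) (Plus (Var x) (N 1)))"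
  have loop: "j \<le> n \<Longrightarrow> r x 0 = j \<Longrightarrow> P j r \<Longrightarrow> runs ?W r ((n - j) * (T + 2) + 1) (P n)" for j r
  proof (induction "n - j" arbitrary: j r)
    case 0
    then have stop: "aval (Minus e (Var x)) r = 0" and "j = n" using bound[OF 0(4)] by auto
    with exec.WhileFalse[OF stop] 0(4) show ?case unfolding runs_def using le_add2 by blast
  next
    case (Suc d)
    then have "j < n" by simp
    from step[OF this Suc.prems(2,3)] obtain t r1 where r1: "exec c r t r1" "t \<le> T"
        "r1 x 0 = j" "P (Suc j) (r1(x := (r1 x)(0 := Suc j)))"
      unfolding runs_def by blast
    let ?r = "r1(x := (r1 x)(0 := Suc j))"
    have body: "exec (c ;; Assign x (N 0) (Plus (Var x) (N 1))) r (t + 1) ?r"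
      using exec.Seq[OF r1(1) exec.Assign[of x "N 0" "Plus (Var x) (N 1)"]] r1(3) by simp
    have "runs ?W ?r ((n - Suc j) * (T + 2) + 1) (P n)"
      using Suc.hyps(2) r1(4) \<open>j < n\<close> by (intro Suc.hyps(1)) auto
    then obtain u r2 where r2: "exec ?W ?r u r2" "u \<le> (n - Suc j) * (T + 2) + 1" "P n r2"
      unfolding runs_def by blast
    have "aval (Minus e (Var x)) r \<noteq> 0"
      using bound[OF Suc.prems(3)] \<open>j < n\<close> Suc.prems(2) by simp
    from exec.WhileTrue[OF this body r2(1)] have "exec ?W r (t + 1 + u + 1) r2" .
    moreover have "n - j = Suc (n - Suc j)" using \<open>j < n\<close> by simp
    then have "t + 1 + u + 1 \<le> (n - j) * (T + 2) + 1" using r1(2) r2(2) by simp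
    ultimately show ?case using r2(3) unfolding runs_def by blast
  qed
  have "runs (For x e c) s (1 + ((n - 0) * (T + 2) + 1)) (P n)"
    unfolding For_def by (intro runs_Seq runs_Assign loop) (use init in auto)
  then show ?thesis by simp
qed

section \<open>A greedy procedure for maximal independent sets\<close>

text \<open>Clears the flag \<open>b\<close> if the current vertex has a neighbour in the set held
  in \<open>I\<close>. Nested conditionals replace a conjunction, and \<open>r\<close> advances in
  every case, so a full scan leaves it at the start of the next row.\<close>

definition scan_neighbours :: com where
  "scan_neighbours =
     For ''w'' (Var ''n'')
       (If (Arr ''adj'' (Var ''r''))
          (If (Arr ''I'' (Var ''w'')) (Assign ''b'' (N 0) (N 0)) Skip) Skip ;;
        Assign ''r'' (N 0) (Plus (Var ''r'') (N 1)))"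

text \<open>
  The machine has no multiplication. The position \<open>v * n + w\<close> in the adjacency matrix is
  therefore tracked by the counter \<open>r\<close>, which is never reset.
\<close>

definition greedy_mis :: com where
  "greedy_mis =
     For ''v'' (Var ''n'') (Assign ''I'' (Var ''v'') (N 0)) ;;
     Assign ''r'' (N 0) (N 0) ;;
     For ''v'' (Var ''n'')
       (Assign ''b'' (N 0) (Minus (N 1) (Arr ''D'' (Var ''v''))) ;;
        scan_neighbours ;;
        If (Var ''b'') (Assign ''I'' (Var ''v'') (N 1)) Skip)"

abbreviation same_input :: "state \<Rightarrow> state \<Rightarrow> bool" where
  "same_input s r \<equiv> (\<forall>x\<in>{''n'', ''adj'', ''D'', ''i''}. r x = s x)"

text \<open>\<open>B\<close> is the value of the flag on entry and \<open>A\<close> the set stored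
  in \<open>I\<close>. One pass costs at most 4 steps, for two tests, an assignment and the
  increment of \<open>r\<close>; loop control adds 2.\<close>

lemma runs_scan_neighbours:
  assumes enc: "encodes_graph s G" and inp: "same_input s r"
    and v: "v < s ''n'' 0" and "r ''r'' 0 = v * s ''n'' 0" and "r ''b'' 0 = (if B then 1 else 0)"
    and "\<And>w. w < s ''n'' 0 \<Longrightarrow> r ''I'' w = (if w \<in> A then 1 else 0)"
  shows "runs scan_neighbours r (s ''n'' 0 * 6 + 2)
    (\<lambda>r'. same_input s r' \<and> r' ''I'' = r ''I'' \<and> r' ''v'' = r ''v'' \<and>
      r' ''r'' 0 = Suc v * s ''n'' 0 \<and>
      r' ''b'' 0 = (if B \<and> (\<forall>w<s ''n'' 0. w \<in> A \<longrightarrow> \<not> v \<rightarrow>\<^bsub>G\<^esub> w) then 1 else 0))"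
proof -
  define n where "n = s ''n'' 0"
  define P where "P j r' \<longleftrightarrow> same_input s r' \<and> r' ''I'' = r ''I'' \<and> r' ''v'' = r ''v'' \<and>
    r' ''r'' 0 = v * n + j \<and>
    r' ''b'' 0 = (if B \<and> (\<forall>w<j. w \<in> A \<longrightarrow> \<not> v \<rightarrow>\<^bsub>G\<^esub> w) then 1 else 0)" for j r'
  have adj: "s ''adj'' (v * n + w) = (if v \<rightarrow>\<^bsub>G\<^esub> w then 1 else 0)" if "w < n" for w
    using enc that v unfolding encodes_graph_def n_def Let_def by blast
  have "runs scan_neighbours r (n * (4 + 2) + 2) (P n)"
    unfolding scan_neighbours_def
  proof (rule runs_For)
    show "P 0 (r(''w'' := (r ''w'')(0 := 0)))"
      using assms by (simp add: P_def n_def)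
    show "aval (Var ''n'') r' = n" if "P j r'" for j r'
      using that by (simp add: P_def n_def)
    show "runs
        (If (Arr ''adj'' (Var ''r''))
          (If (Arr ''I'' (Var ''w'')) (Assign ''b'' (N 0) (N 0)) Skip) Skip ;;
         Assign ''r'' (N 0) (Plus (Var ''r'') (N 1))) r' 4
        (\<lambda>r''. r'' ''w'' 0 = j \<and> P (Suc j) (r''(''w'' := (r'' ''w'')(0 := Suc j))))"
      (is "runs _ _ _ ?Q")
      if "j < n" "r' ''w'' 0 = j" "P j r'" for j r'
    proof -
      have I: "r' ''I'' j = (if j \<in> A then 1 else 0)"
        using assms that by (simp add: P_def n_def)
      let ?fin = "\<lambda>q. runs (Assign ''r'' (N 0) (Plus (Var ''r'') (N 1))) q 1 ?Q"
      have "runs (If (Arr ''adj'' (Var ''r''))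
          (If (Arr ''I'' (Var ''w'')) (Assign ''b'' (N 0) (N 0)) Skip) Skip) r' (Suc (Suc 1)) ?fin"
      proof (rule runs_If)
        assume "aval (Arr ''adj'' (Var ''r'')) r' \<noteq> 0"
        then have e: "v \<rightarrow>\<^bsub>G\<^esub> j" using that adj[OF that(1)] by (auto simp: P_def split: if_splits)
        show "runs (If (Arr ''I'' (Var ''w'')) (Assign ''b'' (N 0) (N 0)) Skip) r' (Suc 1) ?fin"
        proof (rule runs_If)
          assume "aval (Arr ''I'' (Var ''w'')) r' \<noteq> 0"
          then have "j \<in> A" using I that(2) by (auto split: if_splits)
          with e that show "runs (Assign ''b'' (N 0) (N 0)) r' 1 ?fin"
            by (intro runs_Assign) (auto simp: P_def)
        next
          assume "aval (Arr ''I'' (Var ''w'')) r' = 0"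
          then have "j \<notin> A" using I that(2) by (auto split: if_splits)
          with that show "runs Skip r' 1 ?fin"
            by (intro runs_Skip runs_Assign) (auto simp: P_def less_Suc_eq)
        qed
      next
        assume "aval (Arr ''adj'' (Var ''r'')) r' = 0"
        then have "\<not> v \<rightarrow>\<^bsub>G\<^esub> j"
          using that adj[OF that(1)] by (auto simp: P_def split: if_splits)
        with that have "runs Skip r' 1 ?fin"
          by (intro runs_Skip runs_Assign) (auto simp: P_def less_Suc_eq)
        then show "runs Skip r' (Suc 1) ?fin" by (rule runs_mono) auto
      qed
      from runs_Seq[OF this] show ?thesis by (rule runs_mono) simp_all
    qed
  qed
  then show ?thesis by (rule runs_mono) (auto simp: P_def n_def)
qed

text \<open>Vertices are treated in increasing order and added when they lie outside
  \<open>X\<close> and have no neighbour in the set so far. Each rejected vertex outside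
  \<open>X\<close> is then dominated, so the final set is maximal.\<close>

lemma runs_greedy_mis:
  assumes "graph G" and enc: "encodes_graph s G" and X: "encodes_vertex_set s ''D'' G X"
  defines "n \<equiv> s ''n'' 0"
  shows "runs greedy_mis s (n * 3 + 2 + (1 + (n * (n * 6 + 7) + 2)))
    (\<lambda>r. same_input s r \<and> (\<exists>I. maximal_independent_set (remove_vertices G X) I \<and>
      encodes_vertex_set r ''I'' G I))"
proof -
  interpret graph G by fact
  have verts: "verts G = {..<n}" using enc unfolding encodes_graph_def n_def Let_def by blast
  have D: "s ''D'' v = (if v \<in> X then 1 else 0)" if "v < n" for v
    using X that verts unfolding encodes_vertex_set_def by blast
  \<comment> \<open>\<open>A\<close> is independent and dominates the vertices below
    \<open>j\<close> outside \<open>X\<close>. The array is described on all of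
    \<open>{..<n}\<close> because every scan reads it completely, which is why it is cleared
    first.\<close>
  define P where "P j r \<longleftrightarrow> same_input s r \<and> r ''r'' 0 = j * n \<and>
    (\<exists>A. A \<subseteq> {..<j} - X \<and> (\<forall>u\<in>A. \<forall>v\<in>A. \<not> u \<rightarrow>\<^bsub>G\<^esub> v) \<and>
      (\<forall>v\<in>{..<j} - X - A. \<exists>u\<in>A. v \<rightarrow>\<^bsub>G\<^esub> u) \<and>
      (\<forall>v<n. r ''I'' v = (if v \<in> A then 1 else 0)))" for j r
  define Z where "Z j r \<longleftrightarrow> same_input s r \<and> (\<forall>v<j. r ''I'' v = 0)" for j r
  let ?clear = "For ''v'' (Var ''n'') (Assign ''I'' (Var ''v'') (N 0))"
  let ?body = "Assign ''b'' (N 0) (Minus (N 1) (Arr ''D'' (Var ''v''))) ;; scan_neighbours ;;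
    If (Var ''b'') (Assign ''I'' (Var ''v'') (N 1)) Skip"
  have clear: "runs ?clear s (n * (1 + 2) + 2) (Z n)"
  proof (rule runs_For)
    show "runs (Assign ''I'' (Var ''v'') (N 0)) r 1
        (\<lambda>r'. r' ''v'' 0 = j \<and> Z (Suc j) (r'(''v'' := (r' ''v'')(0 := Suc j))))"
      if "j < n" "r ''v'' 0 = j" "Z j r" for j r
      using that by (intro runs_Assign) (auto simp: Z_def less_Suc_eq)
  qed (auto simp: Z_def n_def)
  have body: "runs ?body r (1 + (n * 6 + 2 + Suc 1))
      (\<lambda>r'. r' ''v'' 0 = j \<and> P (Suc j) (r'(''v'' := (r' ''v'')(0 := Suc j))))"
    (is "runs _ _ _ ?Q") if j: "j < n" "r ''v'' 0 = j" "P j r" for j r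
  proof -
    from j(3) obtain A where A: "A \<subseteq> {..<j} - X" "\<forall>u\<in>A. \<forall>v\<in>A. \<not> u \<rightarrow>\<^bsub>G\<^esub> v"
        "\<forall>v\<in>{..<j} - X - A. \<exists>u\<in>A. v \<rightarrow>\<^bsub>G\<^esub> u" "\<And>v. v < n \<Longrightarrow> r ''I'' v = (if v \<in> A then 1 else 0)"
      and r: "same_input s r" "r ''r'' 0 = j * n" unfolding P_def by auto
    have An: "A \<subseteq> {..<n}" using A(1) j(1) by auto
    \<comment> \<open>Starting the flag at 1 minus the entry of \<open>D\<close> excludes the
      vertices of \<open>X\<close>.\<close>
    let ?r = "r(''b'' := (r ''b'')(0 := if j \<notin> X then 1 else 0))"
    have "runs scan_neighbours ?r (n * 6 + 2) (\<lambda>r'. same_input s r' \<and> r' ''I'' = ?r ''I'' \<and>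
        r' ''v'' = ?r ''v'' \<and> r' ''r'' 0 = Suc j * n \<and>
        r' ''b'' 0 = (if j \<notin> X \<and> (\<forall>w<n. w \<in> A \<longrightarrow> \<not> j \<rightarrow>\<^bsub>G\<^esub> w) then 1 else 0))"
      (is "runs _ _ _ ?R")
      unfolding n_def
      by (rule runs_scan_neighbours[OF enc]) (use j r A(4) in \<open>auto simp: n_def\<close>)
    moreover have "runs (If (Var ''b'') (Assign ''I'' (Var ''v'') (N 1)) Skip) r' (Suc 1) ?Q"
      if r': "?R r'" for r'
    proof (rule runs_If)
      assume "aval (Var ''b'') r' \<noteq> 0"
      with r' An have new: "j \<notin> X" "\<forall>w\<in>A. \<not> j \<rightarrow>\<^bsub>G\<^esub> w" by (auto split: if_splits)
      have indep: "\<forall>u\<in>insert j A. \<forall>v\<in>insert j A. \<not> u \<rightarrow>\<^bsub>G\<^esub> v"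
        using new A(2) dominates_sym adj_not_same by blast
      have maxi: "\<forall>v\<in>{..<Suc j} - X - insert j A. \<exists>u\<in>insert j A. v \<rightarrow>\<^bsub>G\<^esub> u"
        using A(3) by (auto simp: less_Suc_eq)
      have "insert j A \<subseteq> {..<Suc j} - X" using A(1) new by auto
      with indep maxi r' j A(4) show "runs (Assign ''I'' (Var ''v'') (N 1)) r' 1 ?Q"
        by (intro runs_Assign) (auto simp: P_def intro!: exI[of _ "insert j A"])
    next
      assume "aval (Var ''b'') r' = 0"
      with r' have "j \<in> X \<or> (\<exists>w\<in>A. j \<rightarrow>\<^bsub>G\<^esub> w)" by (auto split: if_splits)
      then have maxi: "\<forall>v\<in>{..<Suc j} - X - A. \<exists>u\<in>A. v \<rightarrow>\<^bsub>G\<^esub> u"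
        using A(3) by (auto simp: less_Suc_eq)
      have "A \<subseteq> {..<Suc j} - X" using A(1) by auto
      with maxi r' j A(2,4) show "runs Skip r' 1 ?Q"
        by (intro runs_Skip) (auto simp: P_def intro!: exI[of _ A])
    qed
    ultimately have "runs scan_neighbours ?r (n * 6 + 2)
        (\<lambda>r'. runs (If (Var ''b'') (Assign ''I'' (Var ''v'') (N 1)) Skip) r' (Suc 1) ?Q)"
      by (rule runs_mono[OF _ order_refl])
    moreover have "aval (Minus (N 1) (Arr ''D'' (Var ''v''))) r = (if j \<notin> X then 1 else 0)"
      using r(1) D[OF j(1)] j(2) by simp
    ultimately show ?thesis by (intro runs_Seq runs_Assign) simp
  qed
  have main: "runs (For ''v'' (Var ''n'') ?body) r (n * (1 + (n * 6 + 2 + Suc 1) + 2) + 2) (P n)"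
    if "Z n r" "r ''r'' 0 = 0" for r
  proof (rule runs_For)
    show "P 0 (r(''v'' := (r ''v'')(0 := 0)))" using that by (auto simp: P_def Z_def)
    show "aval (Var ''n'') r' = n" if "P j r'" for j r' using that by (simp add: P_def n_def)
  qed (rule body)
  have "runs greedy_mis s (n * (1 + 2) + 2 + (1 + (n * (1 + (n * 6 + 2 + Suc 1) + 2) + 2))) (P n)"
    unfolding greedy_mis_def
  proof (rule runs_Seq, rule runs_mono[OF clear order_refl], rule runs_Seq, rule runs_Assign)
    fix r assume "Z n r"
    then show "runs (For ''v'' (Var ''n'') ?body)
      (r(''r'' := (r ''r'')(aval (N 0) r := aval (N 0) r)))
      (n * (1 + (n * 6 + 2 + Suc 1) + 2) + 2) (P n)"
      by (intro main) (auto simp: Z_def)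
  qed
  then show ?thesis
  proof (rule runs_mono)
    fix r assume "P n r"
    then obtain A where "same_input s r" "A \<subseteq> {..<n} - X" "\<forall>u\<in>A. \<forall>v\<in>A. \<not> u \<rightarrow>\<^bsub>G\<^esub> v"
        "\<forall>v\<in>{..<n} - X - A. \<exists>u\<in>A. v \<rightarrow>\<^bsub>G\<^esub> u" "\<forall>v<n. r ''I'' v = (if v \<in> A then 1 else 0)"
      unfolding P_def by blast
    then show "same_input s r \<and> (\<exists>I. maximal_independent_set (remove_vertices G X) I \<and>
      encodes_vertex_set r ''I'' G I)"
      by (auto simp: maximal_independent_remove_iff encodes_vertex_set_def verts
        intro!: exI[of _ A])
  qed (simp add: algebra_simps)
qed

text \<open>Provides the subroutine whose existence keeps the claim about all \<open>M\<close> from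
  being vacuous.\<close>

lemma greedy_mis_procedure: "poly_time_mis_procedure greedy_mis"
  unfolding poly_time_mis_procedure_def
\<comment> \<open>With \<open>n\<close> vertices the bound for \<open>greedy_mis\<close> expands to
  \<open>6 * n^2 + 10 * n + 5\<close>; coefficients are listed from the constant term up.\<close>
proof (intro exI[of _ "[:5, 10, 6:]"] allI impI, elim conjE)
  fix G :: "(nat, nat \<times> nat) pre_digraph" and X s
  assume *: "graph G" "encodes_graph s G" "encodes_vertex_set s ''D'' G X"
  have "card (verts G) = s ''n'' 0" using *(2) by (simp add: encodes_graph_def Let_def)
  with runs_greedy_mis[OF *] show "\<exists>t s' I. exec greedy_mis s t s' \<and>
      t \<le> poly [:5, 10, 6:] (card (verts G)) \<and>
      maximal_independent_set (remove_vertices G X) I \<and> encodes_vertex_set s' ''I'' G I \<and>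
      (\<forall>x\<in>{''n'', ''adj'', ''D'', ''i''}. s' x = s x)"
    unfolding runs_def by (fastforce simp: algebra_simps)
qed

section \<open>The running time of the algorithm\<close>

lemma run_output_Suc: "run_output (Suc j) I = run_output j I \<union> I (Suc j)"
  by (auto simp: run_output_def atLeastAtMostSuc_conv)

lemma run_output_cong: "(\<And>i. i \<in> {1..j} \<Longrightarrow> I i = J i) \<Longrightarrow> run_output j I = run_output j J"
  by (simp add: run_output_def)

text \<open>The set removed before round \<open>i\<close> involves only indices below
  \<open>i\<close>, so changing \<open>I\<close> at \<open>Suc j\<close> leaves the earlier rounds
  intact, and the set removed before round \<open>Suc j\<close> is the output so far.\<close>

lemma algorithm_run_Suc:
  assumes "algorithm_run j G I"
    and "maximal_independent_set (remove_vertices G (run_output j I)) A"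
  shows "algorithm_run (Suc j) G (I(Suc j := A))"
  unfolding algorithm_run_def
proof
  fix i assume i: "i \<in> {1..Suc j}"
  have "(\<Union>l\<in>{1..<i}. (I(Suc j := A)) l) = (\<Union>l\<in>{1..<i}. I l)"
    using i by (intro SUP_cong) auto
  moreover have "(\<Union>l\<in>{1..<Suc j}. I l) = run_output j I"
    by (simp add: run_output_def atLeastLessThanSuc_atLeastAtMost)
  ultimately show "maximal_independent_set
      (remove_vertices G (\<Union>l\<in>{1..<i}. (I(Suc j := A)) l)) ((I(Suc j := A)) i)"
    using assms i unfolding algorithm_run_def by (cases "i = Suc j") auto
qed

text \<open>After \<open>j\<close> passes the array \<open>D\<close> holds the output of a run with
  \<open>j\<close> rounds, assembled from the answers of \<open>M\<close>. The counter starts at 0,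
  so pass \<open>j\<close> produces round \<open>Suc j\<close>. \<open>M\<close> is assumed correct
  from every suitable state, since its working memory holds leftovers of earlier calls.\<close>

lemma runs_algorithm_program:
  assumes "graph G" and enc: "encodes_graph s G"
    and M: "\<And>X r. encodes_graph r G \<Longrightarrow> encodes_vertex_set r ''D'' G X \<Longrightarrow>
      runs M r T (\<lambda>r'. same_input r r' \<and>
        (\<exists>I. maximal_independent_set (remove_vertices G X) I \<and> encodes_vertex_set r' ''I'' G I))"
  defines "n \<equiv> s ''n'' 0"
  shows "runs (algorithm_program k M) s (n * 3 + 2 + (k * (T + (n * 4 + 2) + 2) + 2))
    (\<lambda>r. \<exists>I. algorithm_run k G I \<and> encodes_vertex_set r ''D'' G (run_output k I))"
proof -
  define G_in where "G_in r \<longleftrightarrow> r ''n'' = s ''n'' \<and> r ''adj'' = s ''adj''" for r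
  have verts: "verts G = {..<n}" using enc unfolding encodes_graph_def n_def Let_def by blast
  have G_enc: "encodes_graph r G" if "G_in r" for r
    using enc that by (simp add: G_in_def encodes_graph_def)
  define Z where "Z j r \<longleftrightarrow> G_in r \<and> (\<forall>v<j. r ''D'' v = 0)" for j r
  define P where "P j r \<longleftrightarrow> G_in r \<and>
    (\<exists>I. algorithm_run j G I \<and> encodes_vertex_set r ''D'' G (run_output j I))" for j r
  let ?clear = "For ''v'' (Var ''n'') (Assign ''D'' (Var ''v'') (N 0))"
  let ?add = "For ''v'' (Var ''n'')
    (If (Arr ''I'' (Var ''v'')) (Assign ''D'' (Var ''v'') (N 1)) Skip)"
  have clear: "runs ?clear s (n * (1 + 2) + 2) (Z n)"
  proof (rule runs_For)
    show "runs (Assign ''D'' (Var ''v'') (N 0)) r 1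
        (\<lambda>r'. r' ''v'' 0 = j \<and> Z (Suc j) (r'(''v'' := (r' ''v'')(0 := Suc j))))"
      if "j < n" "r ''v'' 0 = j" "Z j r" for j r
      using that by (intro runs_Assign) (auto simp: Z_def G_in_def less_Suc_eq)
  qed (auto simp: Z_def G_in_def n_def)
  have add: "runs ?add r (n * (Suc 1 + 2) + 2) (\<lambda>r'. G_in r' \<and> r' ''i'' = r ''i'' \<and>
      encodes_vertex_set r' ''D'' G (X \<union> A))"
    if r: "G_in r" "encodes_vertex_set r ''D'' G X" "encodes_vertex_set r ''I'' G A" for r X A
  proof -
    define Q where "Q j r' \<longleftrightarrow> G_in r' \<and> r' ''i'' = r ''i'' \<and> r' ''I'' = r ''I'' \<and>
      (\<forall>v<n. r' ''D'' v = (if v \<in> X \<or> v \<in> A \<and> v < j then 1 else 0))" for j r'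
    have rI: "r ''I'' v = (if v \<in> A then 1 else 0)" if "v < n" for v
      using r(3) verts that by (simp add: encodes_vertex_set_def)
    have "runs ?add r (n * (Suc 1 + 2) + 2) (Q n)"
    proof (rule runs_For)
      show "Q 0 (r(''v'' := (r ''v'')(0 := 0)))"
        using r verts by (auto simp: Q_def G_in_def encodes_vertex_set_def)
      show "aval (Var ''n'') r' = n" if "Q j r'" for j r'
        using that by (simp add: Q_def G_in_def n_def)
      show "runs (If (Arr ''I'' (Var ''v'')) (Assign ''D'' (Var ''v'') (N 1)) Skip) r' (Suc 1)
          (\<lambda>r''. r'' ''v'' 0 = j \<and> Q (Suc j) (r''(''v'' := (r'' ''v'')(0 := Suc j))))"
        if "j < n" "r' ''v'' 0 = j" "Q j r'" for j r'
        using that rI[OF that(1)]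
        by (intro runs_If runs_Assign runs_Skip)
          (auto simp: Q_def G_in_def less_Suc_eq split: if_splits)
    qed
    then show ?thesis
      by (rule runs_mono) (use r verts in \<open>auto simp: Q_def encodes_vertex_set_def\<close>)
  qed
  have body: "runs (M ;; ?add) r (T + (n * (Suc 1 + 2) + 2))
      (\<lambda>r'. r' ''i'' 0 = j \<and> P (Suc j) (r'(''i'' := (r' ''i'')(0 := Suc j))))"
    if j: "r ''i'' 0 = j" "P j r" for j r
  proof (rule runs_Seq)
    from j(2) obtain I where r: "G_in r"
        and I: "algorithm_run j G I" "encodes_vertex_set r ''D'' G (run_output j I)"
      unfolding P_def by blast
    show "runs M r T (\<lambda>r1. runs ?add r1 (n * (Suc 1 + 2) + 2)
      (\<lambda>r'. r' ''i'' 0 = j \<and> P (Suc j) (r'(''i'' := (r' ''i'')(0 := Suc j)))))"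
    proof (rule runs_mono[OF M[OF G_enc[OF r] I(2)] order_refl], elim conjE exE)
      fix r1 A assume r1: "same_input r r1" "encodes_vertex_set r1 ''I'' G A"
        and A: "maximal_independent_set (remove_vertices G (run_output j I)) A"
      have "G_in r1" "encodes_vertex_set r1 ''D'' G (run_output j I)"
        using r1(1) r I(2) by (auto simp: G_in_def encodes_vertex_set_def)
      moreover have "run_output j I \<union> A = run_output (Suc j) (I(Suc j := A))"
        using run_output_cong[of j I "I(Suc j := A)"] by (simp add: run_output_Suc)
      ultimately have "runs ?add r1 (n * (Suc 1 + 2) + 2) (\<lambda>r'. G_in r' \<and> r' ''i'' = r1 ''i'' \<and>
          encodes_vertex_set r' ''D'' G (run_output (Suc j) (I(Suc j := A))))"
        using add[of r1 "run_output j I" A] r1(2) by simp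
      then show "runs ?add r1 (n * (Suc 1 + 2) + 2)
          (\<lambda>r'. r' ''i'' 0 = j \<and> P (Suc j) (r'(''i'' := (r' ''i'')(0 := Suc j))))"
        using algorithm_run_Suc[OF I(1) A] r1(1) j(1)
        by (elim runs_mono) (auto simp: P_def G_in_def encodes_vertex_set_def)
    qed
  qed
  have main: "runs (For ''i'' (N k) (M ;; ?add)) r
      (k * (T + (n * (Suc 1 + 2) + 2) + 2) + 2) (P k)" if "Z n r" for r
  proof (rule runs_For)
    have "algorithm_run 0 G (\<lambda>_. {})" by (simp add: algorithm_run_def)
    with that verts show "P 0 (r(''i'' := (r ''i'')(0 := 0)))"
      by (auto simp: P_def Z_def G_in_def encodes_vertex_set_def run_output_def)
    show "aval (N k) r' = k" for r' by simp
  qed (rule body)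
  have "runs (algorithm_program k M) s
      (n * (1 + 2) + 2 + (k * (T + (n * (Suc 1 + 2) + 2) + 2) + 2)) (P k)"
    unfolding algorithm_program_def
    by (intro runs_Seq runs_mono[OF clear order_refl] main)
  then show ?thesis by (rule runs_mono) (auto simp: P_def)
qed

text \<open>The number \<open>k\<close> is a constant of the program, so it may enter the
  coefficients; one polynomial then serves all graphs and start states.\<close>

lemma algorithm_program_poly_time:
  assumes "poly_time_mis_procedure M"
  shows "\<exists>q :: nat poly. \<forall>G s. graph G \<and> encodes_graph s G \<longrightarrow>
    (\<exists>t s' I. exec (algorithm_program k M) s t s' \<and> t \<le> poly q (card (verts G)) \<and>
      algorithm_run k G I \<and> encodes_vertex_set s' ''D'' G (run_output k I))"
proof -
  obtain q :: "nat poly" where q: "\<forall>G X s.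
      graph G \<and> encodes_graph s G \<and> encodes_vertex_set s ''D'' G X \<longrightarrow>
      (\<exists>t s' I. exec M s t s' \<and> t \<le> poly q (card (verts G)) \<and>
        maximal_independent_set (remove_vertices G X) I \<and> encodes_vertex_set s' ''I'' G I \<and>
        same_input s s')"
    using assms unfolding poly_time_mis_procedure_def by (elim exE)
  have M: "runs M s (poly q (card (verts G))) (\<lambda>r. same_input s r \<and>
      (\<exists>I. maximal_independent_set (remove_vertices G X) I \<and> encodes_vertex_set r ''I'' G I))"
    if "graph G" "encodes_graph s G" "encodes_vertex_set s ''D'' G X" for G X s
  proof -
    from q[rule_format, OF conjI[OF that(1) conjI[OF that(2,3)]]] show ?thesis
      unfolding runs_def by (elim exE conjE) (intro exI conjI)
  qed
  \<comment> \<open>The part \<open>4 + 3 * n\<close> pays for clearing \<open>D\<close> and for the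
    overhead of the outer loop; each of the \<open>k\<close> rounds costs a call of \<open>M\<close>
    and \<open>4 * n + 4\<close> for merging and loop control.\<close>
  define q' where "q' = [:4, 3:] + of_nat k * (q + [:4, 4:])"
  have "\<exists>t s' I. exec (algorithm_program k M) s t s' \<and> t \<le> poly q' (card (verts G)) \<and>
      algorithm_run k G I \<and> encodes_vertex_set s' ''D'' G (run_output k I)"
    if G: "graph G" "encodes_graph s G" for G s
  proof -
    have n: "s ''n'' 0 = card (verts G)" using G(2) by (simp add: encodes_graph_def Let_def)
    have "s ''n'' 0 * 3 + 2 + (k * (poly q (card (verts G)) + (s ''n'' 0 * 4 + 2) + 2) + 2) =
        poly q' (card (verts G))"
      unfolding n by (simp add: q'_def algebra_simps)
    with runs_algorithm_program[OF G M[OF G(1)]] show ?thesis unfolding runs_def by metis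
  qed
  then show ?thesis by blast
qed

theorem theorem11:
  fixes p k :: nat
  assumes "p \<ge> 2" and "k \<ge> 1"
  shows
    "(\<exists>M. poly_time_mis_procedure M) \<and>
     (\<forall>M. poly_time_mis_procedure M \<longrightarrow>
        (\<exists>q :: nat poly. \<forall>G s.
           graph G \<and> no_isolated_vertices G \<and> claw_free p G \<and> encodes_graph s G \<longrightarrow>
           (\<exists>t s' I.
              exec (algorithm_program k M) s t s' \<and> t \<le> poly q (card (verts G)) \<and>
              algorithm_run k G I \<and> encodes_vertex_set s' ''D'' G (run_output k I)))) \<and>
     (\<forall>(G :: ('a, 'b) pre_digraph) I.
        graph G \<and> no_isolated_vertices G \<and> claw_free p G \<and> algorithm_run k G I \<longrightarrow>
        k_dominating_set k G (run_output k I) \<and>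
        card (run_output k I) \<le> max (p - 1) k * k_domination_number k G)"
proof (intro conjI allI impI; (elim conjE)?)
  show "\<exists>M. poly_time_mis_procedure M" using greedy_mis_procedure by blast
next
  fix M assume "poly_time_mis_procedure M"
  from algorithm_program_poly_time[OF this, of k]
  show "\<exists>q :: nat poly. \<forall>G s.
      graph G \<and> no_isolated_vertices G \<and> claw_free p G \<and> encodes_graph s G \<longrightarrow>
      (\<exists>t s' I. exec (algorithm_program k M) s t s' \<and> t \<le> poly q (card (verts G)) \<and>
        algorithm_run k G I \<and> encodes_vertex_set s' ''D'' G (run_output k I))"
    by blast
next
  fix G :: "('a, 'b) pre_digraph" and I
  assume G: "graph G" "claw_free p G" "algorithm_run k G I"
  from G(1) interpret graph G .
  show "k_dominating_set k G (run_output k I)" using G(3) by (rule run_output_dominating)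
  \<comment> \<open>The size bound holds for every \<open>k\<close>-dominating set; a minimum one
    turns it into the ratio.\<close>
  obtain S where "k_dominating_set k G S" "card S = k_domination_number k G"
    by (rule k_domination_number_attained)
  with card_run_output_le[OF assms(2) G(2,3)]
  show "card (run_output k I) \<le> max (p - 1) k * k_domination_number k G" by metis
qed

end
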